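(* Let $(\pi_t)_{t\ge 0}$ be the half-step evolution (product chain) of an alternating Markov chain on $\mathcal{X}\times\mathcal{Y}$, started from an arbitrary probability distribution $\pi_0$ on $\mathcal{X}\times\mathcal{Y}$, and let $t_0$ be its burn-in time. Then for all $t\ge t_0$, $$D_{\mathrm{RKL}}(\pi_{\mathrm{ES}},\pi_t)=D_{\mathrm{RKL}}(\pi_{\mathrm{ES}},\pi_{t+1})+D_{\mathrm{RKL}}(\pi_{t+1},\pi_t).$$ Consequently, the sequence $(D_{\mathrm{KL}}(\pi_t,\pi_{\mathrm{ES}}))_{t\ge t_0}$ is monotonically non-increasing. Additionally, writing $\mu_k:=(\pi_k)_{\mathcal{X}}$, $\nu_k:=(\pi_k)_{\mathcal{Y}}$, $\mu_{\mathrm{ES}}:=(\pi_{\mathrm{ES}})_{\mathcal{X}}$, $\nu_{\mathrm{ES}}:=(\pi_{\mathrm{ES}})_{\mathcal{Y}}$, for all even $t$ greater than $t_0$, $$D_{\mathrm{RKL}}(\mu_{\mathrm{ES}},\mu_t)\ \ge\ D_{\mathrm{RKL}}(\mu_{\mathrm{ES}},\mu_{t+1})\ \ge\ D_{\mathrm{RKL}}(\nu_{\mathrm{ES}},\nu_{t+1})\ \ge\ D_{\mathrm{RKL}}(\nu_{\mathrm{ES}},\nu_{t+2})\ \ge\ D_{\mathrm{RKL}}(\mu_{\mathrm{ES}},\mu_{t+2}).$$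
   Context: **Alternating Markov chain.** $\mathcal{X},\mathcal{Y}$ are finite sets. Fixed conditional distributions are given: for each $x\in\mathcal{X}$ a probability distribution $P[\cdot\,|x]$ on $\mathcal{Y}$ and for each $y\in\mathcal{Y}$ a probability distribution $P[\cdot\,|y]$ on $\mathcal{X}$. For a distribution $\pi$ on $\mathcal{X}\times\mathcal{Y}$, $\pi_{\mathcal{X}},\pi_{\mathcal{Y}}$ denote its marginals. Starting from a probability distribution $\pi_0$ on $\mathcal{X}\times\mathcal{Y}$, the product chain evolves by $$\pi_{t+1}(x,y)=\begin{cases}P[y|x]\,(\pi_t)_{\mathcal{X}}(x), & t \text{ even},\\ P[x|y]\,(\pi_t)_{\mathcal{Y}}(y), & t\text{ odd}.\end{cases}$$ The primal chain is the Markov chain on $\mathcal{X}$ with transition probabilities $K(x,x')=\sum_{y\in\mathcal{Y}}P[y|x]P[x'|y]$; it is assumed irreducible and aperiodic. (The dual chain is the analogous two-step chain on $\mathcal{Y}$.) **Compatibility and Edwards-Sokal measure.** It is assumed that there exists a probability distribution $\pi$ on $\mathcal{X}\times\mathcal{Y}$ satisfying both, for all $A\subseteq\mathcal{X}$, $B\subseteq\mathcal{Y}$, $$\pi(A\times B)=\sum_{x\in A}P[B|x]\,\pi_{\mathcal{X}}(x)\quad\text{and}\quad \pi(A\times B)=\sum_{y\in B}P[A|y]\,\pi_{\mathcal{Y}}(y).$$ This measure is unique and is denoted $\pi_{\mathrm{ES}}$ (generalized Edwards-Sokal measure). Its $\mathcal{X}$-marginal has full support on $\mathcal{X}$ (by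 ergodicity), and $\mathcal{Y}$ is assumed pruned so that its $\mathcal{Y}$-marginal has full support on $\mathcal{Y}$. Put $\mathcal{T}:=\operatorname{supp}(\pi_{\mathrm{ES}})\subseteq\mathcal{X}\times\mathcal{Y}$. **Burn-in time.** $t_0$ is the first half-step such that $\operatorname{supp}(\pi_{t_0})=\mathcal{T}$ for all choices of initial distribution $\pi_0$. It is finite and $\operatorname{supp}(\pi_t)=\mathcal{T}$ for all $t\ge t_0$. **Divergences.** For probability distributions $p,q$ on the same finite set $\Omega$, $D_{\mathrm{KL}}(p,q)=\sum_{\omega\in\Omega}p(\omega)\log\frac{p(\omega)}{q(\omega)}$ (with $0\log 0=0$, and $+\infty$ if $p$ is not absolutely continuous with respect to $q$), and $D_{\mathrm{RKL}}(p,q):=D_{\mathrm{KL}}(q,p)$. *)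

theory Defs
  imports "HOL-Probability.Probability"
begin

abbreviation marginal_X :: "('x \<times> 'y) pmf \<Rightarrow> 'x pmf" where
  "marginal_X p \<equiv> map_pmf fst p"

abbreviation marginal_Y :: "('x \<times> 'y) pmf \<Rightarrow> 'y pmf" where
  "marginal_Y p \<equiv> map_pmf snd p"

text \<open>
  The conditional distributions of an alternating Markov chain are two kernels
  \<open>PY :: 'x \<Rightarrow> 'y pmf\<close> and \<open>PX :: 'y \<Rightarrow> 'x pmf\<close>, with \<open>pmf (PY x) y\<close> for \<open>P[y|x]\<close>
  and \<open>pmf (PX y) x\<close> for \<open>P[x|y]\<close>. The finite sets \<open>\<X>\<close> and \<open>\<Y>\<close> are the finite
  types \<open>'x\<close> and \<open>'y\<close>.
\<close>

primrec half_step_evolution ::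
  "('x \<Rightarrow> 'y pmf) \<Rightarrow> ('y \<Rightarrow> 'x pmf) \<Rightarrow> ('x \<times> 'y) pmf \<Rightarrow> nat \<Rightarrow> ('x \<times> 'y) pmf" where
  "half_step_evolution PY PX p0 0 = p0"
| "half_step_evolution PY PX p0 (Suc t) =
    (if even t
     then bind_pmf (marginal_X (half_step_evolution PY PX p0 t)) (\<lambda>x. map_pmf (\<lambda>y. (x, y)) (PY x))
     else bind_pmf (marginal_Y (half_step_evolution PY PX p0 t)) (\<lambda>y. map_pmf (\<lambda>x. (x, y)) (PX y)))"

lemma pmf_half_step_evolution_Suc:
  fixes PY :: "'x::finite \<Rightarrow> 'y::finite pmf" and PX :: "'y \<Rightarrow> 'x pmf"
  shows "pmf (half_step_evolution PY PX p0 (Suc t)) (x, y) =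
    (if even t
     then pmf (PY x) y * pmf (marginal_X (half_step_evolution PY PX p0 t)) x
     else pmf (PX y) x * pmf (marginal_Y (half_step_evolution PY PX p0 t)) y)"
proof -
  have X: "pmf (map_pmf (\<lambda>y. (x', y)) (PY x')) (x, y) = (if x' = x then pmf (PY x) y else 0)" for x'
  proof (cases "x' = x")
    case True
    then show ?thesis by (simp add: pmf_map_inj' inj_def)
  next
    case False
    then show ?thesis by (auto simp: pmf_eq_0_set_pmf)
  qed
  have Y: "pmf (map_pmf (\<lambda>x. (x, y')) (PX y')) (x, y) = (if y' = y then pmf (PX y) x else 0)" for y'
  proof (cases "y' = y")
    case True
    then show ?thesis using pmf_map_inj'[of "\<lambda>x. (x, y)" "PX y" x] by (simp add: inj_def)
  next
    case False
    then show ?thesis by (auto simp: pmf_eq_0_set_pmf)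
  qed
  have BX: "pmf (bind_pmf q (\<lambda>x. map_pmf (\<lambda>y. (x, y)) (PY x))) (x, y) = pmf (PY x) y * pmf q x" for q
    by (simp add: pmf_bind X integral_measure_pmf_real[of UNIV] if_distrib[of "\<lambda>r. r * _"]
        sum.delta cong: if_cong)
  have BY: "pmf (bind_pmf q (\<lambda>y. map_pmf (\<lambda>x. (x, y)) (PX y))) (x, y) = pmf (PX y) x * pmf q y" for q
    by (simp add: pmf_bind Y integral_measure_pmf_real[of UNIV] if_distrib[of "\<lambda>r. r * _"]
        sum.delta cong: if_cong)
  show ?thesis
    by (simp only: half_step_evolution.simps BX BY split: if_split) simp
qed

definition primal_kernel :: "('x \<Rightarrow> 'y pmf) \<Rightarrow> ('y \<Rightarrow> 'x pmf) \<Rightarrow> 'x \<Rightarrow> 'x pmf" where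
  "primal_kernel PY PX x = bind_pmf (PY x) PX"

lemma pmf_primal_kernel:
  fixes PY :: "'x \<Rightarrow> 'y::finite pmf"
  shows "pmf (primal_kernel PY PX x) x' = (\<Sum>y\<in>UNIV. pmf (PY x) y * pmf (PX y) x')"
  by (simp add: primal_kernel_def pmf_bind integral_measure_pmf_real[of UNIV] mult.commute)

primrec n_step :: "('a \<Rightarrow> 'a pmf) \<Rightarrow> nat \<Rightarrow> 'a \<Rightarrow> 'a pmf" where
  "n_step K 0 x = return_pmf x"
| "n_step K (Suc n) x = bind_pmf (K x) (n_step K n)"

definition irreducible_kernel :: "('a \<Rightarrow> 'a pmf) \<Rightarrow> bool" where
  "irreducible_kernel K \<longleftrightarrow> (\<forall>x x'. \<exists>n>0. pmf (n_step K n x) x' > 0)"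

definition aperiodic_kernel :: "('a \<Rightarrow> 'a pmf) \<Rightarrow> bool" where
  "aperiodic_kernel K \<longleftrightarrow> (\<forall>x. Gcd {n. n > 0 \<and> pmf (n_step K n x) x > 0} = 1)"

definition edwards_sokal ::
  "('x \<Rightarrow> 'y pmf) \<Rightarrow> ('y \<Rightarrow> 'x pmf) \<Rightarrow> ('x \<times> 'y) pmf \<Rightarrow> bool" where
  "edwards_sokal PY PX p \<longleftrightarrow> (\<forall>A B.
     measure_pmf.prob p (A \<times> B) =
       (\<Sum>x\<in>A. measure_pmf.prob (PY x) B * pmf (marginal_X p) x) \<and>
     measure_pmf.prob p (A \<times> B) =
       (\<Sum>y\<in>B. measure_pmf.prob (PX y) A * pmf (marginal_Y p) y))"

text \<open>
  The burn-in time does not depend on the initial distribution. Some \<open>t\<close> as below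
  exists if the primal kernel is irreducible and aperiodic, \<open>p_ES\<close> is the
  Edwards-Sokal measure and its \<open>\<Y>\<close>-marginal has full support.
\<close>

definition burn_in_time ::
  "('x \<Rightarrow> 'y pmf) \<Rightarrow> ('y \<Rightarrow> 'x pmf) \<Rightarrow> ('x \<times> 'y) pmf \<Rightarrow> nat" where
  "burn_in_time PY PX p_ES =
    (LEAST t. \<forall>p0. set_pmf (half_step_evolution PY PX p0 t) = set_pmf p_ES)"

text \<open>
  The library's \<open>KL_divergence\<close> is real-valued and has no value \<open>\<infinity>\<close>. Terms with
  \<open>pmf p w = 0\<close> vanish because of the factor \<open>pmf p w\<close>.
\<close>

definition D_KL :: "'a::finite pmf \<Rightarrow> 'a pmf \<Rightarrow> ereal" where
  "D_KL p q =
    (if set_pmf p \<subseteq> set_pmf q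
     then ereal (\<Sum>w\<in>UNIV. pmf p w * ln (pmf p w / pmf q w))
     else \<infinity>)"

definition D_RKL :: "'a::finite pmf \<Rightarrow> 'a pmf \<Rightarrow> ereal" where
  "D_RKL p q = D_KL q p"

end

theory Submission
  imports Defs
begin

text \<open>
  A half-step replaces \<open>p = \<pi>\<^sub>t\<close> by the measure \<open>r = \<pi>\<^sub>t\<^sub>+\<^sub>1\<close> that keeps one marginal of \<open>p\<close> but has
  the same conditionals given that coordinate as \<open>q = \<pi>\<^sub>E\<^sub>S\<close>. Hence \<open>r/q\<close> is a function of that
  coordinate, so \<open>ln (r/q)\<close> has the same mean under \<open>p\<close> and under \<open>r\<close>, and splitting
  \<open>ln (p/q) = ln (p/r) + ln (r/q)\<close> gives the Pythagorean identity. The same observation identifies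
  the divergence of \<open>r\<close> from \<open>q\<close> with that of the retained marginals, so the chain of marginal
  inequalities is again monotonicity along half-steps. If \<open>p\<close> is not absolutely continuous with
  respect to \<open>q\<close>, both sides of the identity are infinite, since absolute continuity is transitive.
\<close>

lemma sum_pmf_map:
  fixes p :: "'a::finite pmf" and g :: "'b::finite \<Rightarrow> real"
  shows "(\<Sum>w\<in>UNIV. pmf p w * g (f w)) = (\<Sum>v\<in>UNIV. pmf (map_pmf f p) v * g v)"
proof -
  have "(\<Sum>w\<in>UNIV. pmf p w * g (f w)) = measure_pmf.expectation p (\<lambda>w. g (f w))"
    by (simp add: integral_measure_pmf_real[of UNIV] mult.commute)
  also have "\<dots> = measure_pmf.expectation (map_pmf f p) g"
    by simp
  also have "\<dots> = (\<Sum>v\<in>UNIV. pmf (map_pmf f p) v * g v)"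
    by (simp add: integral_measure_pmf_real[of UNIV] mult.commute del: integral_map_pmf)
  finally show ?thesis .
qed

text \<open>Gibbs' inequality, from \<open>ln u \<le> u - 1\<close> at
  \<open>u = pmf q w / pmf p w\<close>. The resulting termwise lower bound
  \<open>pmf p w - pmf q w\<close> sums to zero, both masses being one.\<close>

lemma D_KL_nonneg: "0 \<le> D_KL p q"
proof (cases "set_pmf p \<subseteq> set_pmf q")
  case True
  have "pmf p w - pmf q w \<le> pmf p w * ln (pmf p w / pmf q w)" for w
  proof (cases "pmf p w = 0")
    case False
    then have p: "pmf p w > 0" by (simp add: pmf_positive_iff set_pmf_iff)
    with True have q: "pmf q w > 0" by (auto simp: pmf_positive_iff)
    have "ln (pmf q w / pmf p w) \<le> pmf q w / pmf p w - 1"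
      using p q by (intro ln_le_minus_one) simp
    moreover have "ln (pmf q w / pmf p w) = - ln (pmf p w / pmf q w)"
      using p q by (simp add: ln_div)
    ultimately have "1 - pmf q w / pmf p w \<le> ln (pmf p w / pmf q w)" by simp
    then have "pmf p w * (1 - pmf q w / pmf p w) \<le> pmf p w * ln (pmf p w / pmf q w)"
      using p by (intro mult_left_mono) auto
    then show ?thesis using p by (simp add: right_diff_distrib)
  qed simp
  then have "(\<Sum>w\<in>UNIV. pmf p w - pmf q w) \<le> (\<Sum>w\<in>UNIV. pmf p w * ln (pmf p w / pmf q w))"
    by (intro sum_mono)
  then show ?thesis
    using True by (simp add: D_KL_def sum_subtractf sum_pmf_eq_1)
qed (simp add: D_KL_def)

text \<open>The factor \<open>k w\<close> plays the part of the common conditional probability of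
  \<open>w\<close> given \<open>f w\<close>. It cancels in the density ratio, so the sum pushes
  forward along \<open>f\<close>.\<close>

lemma D_KL_same_conditionals:
  fixes q r :: "'a::finite pmf" and f :: "'a \<Rightarrow> 'b::finite"
  assumes r: "\<And>w. pmf r w = k w * pmf (map_pmf f r) (f w)"
    and q: "\<And>w. pmf q w = k w * pmf (map_pmf f q) (f w)"
  shows "D_KL r q = D_KL (map_pmf f r) (map_pmf f q)"
proof -
  \<comment> \<open>This makes the two divergences infinite simultaneously.\<close>
  have "set_pmf r \<subseteq> set_pmf q \<longleftrightarrow> set_pmf (map_pmf f r) \<subseteq> set_pmf (map_pmf f q)"
  proof
    show "set_pmf r \<subseteq> set_pmf q" if sub: "set_pmf (map_pmf f r) \<subseteq> set_pmf (map_pmf f q)"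
    proof
      fix w assume "w \<in> set_pmf r"
      then have "k w * pmf (map_pmf f r) (f w) \<noteq> 0" using r[of w] by (simp add: set_pmf_iff)
      moreover from this have "pmf (map_pmf f q) (f w) \<noteq> 0"
        using sub by (auto simp only: set_pmf_iff subset_iff mult_eq_0_iff)
      ultimately show "w \<in> set_pmf q" using q[of w] by (simp add: set_pmf_iff)
    qed
  qed (auto simp: image_mono)
  moreover have "(\<Sum>w\<in>UNIV. pmf r w * ln (pmf r w / pmf q w))
      = (\<Sum>v\<in>UNIV. pmf (map_pmf f r) v * ln (pmf (map_pmf f r) v / pmf (map_pmf f q) v))"
  proof -
    \<comment> \<open>If \<open>k w = 0\<close> then \<open>pmf r w = 0\<close> and both sides
      vanish; otherwise \<open>k w\<close> cancels. Where the marginal of \<open>q\<close> vanishes,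
      both quotients are zero by the convention for division.\<close>
    have "pmf r w * ln (pmf r w / pmf q w)
        = pmf r w * ln (pmf (map_pmf f r) (f w) / pmf (map_pmf f q) (f w))" for w
      using r[of w] q[of w] by (cases "k w = 0") simp_all
    then show ?thesis
      using sum_pmf_map[of r "\<lambda>v. ln (pmf (map_pmf f r) v / pmf (map_pmf f q) v)" f]
      by (simp only:)
  qed
  ultimately show ?thesis by (simp add: D_KL_def)
qed

lemma D_KL_pythagoras:
  fixes p q r :: "'a::finite pmf" and f :: "'a \<Rightarrow> 'b::finite"
  assumes marg: "map_pmf f r = map_pmf f p"
    and r: "\<And>w. pmf r w = k w * pmf (map_pmf f r) (f w)"
    and q: "\<And>w. pmf q w = k w * pmf (map_pmf f q) (f w)"
  shows "D_KL p q = D_KL r q + D_KL p r"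
proof (cases "set_pmf p \<subseteq> set_pmf q")
  case True
  \<comment> \<open>Splitting the logarithm needs all factors nonzero on the support of
    \<open>p\<close>: two come from \<open>pmf q w \<noteq> 0\<close>, the third from the shared
    marginal of \<open>r\<close> and \<open>p\<close>.\<close>
  have pos: "k w \<noteq> 0 \<and> pmf (map_pmf f r) (f w) \<noteq> 0 \<and> pmf (map_pmf f q) (f w) \<noteq> 0"
    if "w \<in> set_pmf p" for w
  proof -
    have "pmf q w \<noteq> 0" using that True by (auto simp: set_pmf_iff)
    moreover have "f w \<in> set_pmf (map_pmf f r)" using that marg by simp
    then have "pmf (map_pmf f r) (f w) \<noteq> 0" by (simp only: set_pmf_iff not_False_eq_True)
    ultimately show ?thesis using q[of w] by auto
  qed
  have pr: "set_pmf p \<subseteq> set_pmf r"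
    using pos r by (auto simp: set_pmf_iff)
  have "set_pmf (map_pmf f r) \<subseteq> set_pmf (map_pmf f q)"
    using True by (auto simp: marg)
  then have fin: "D_KL r q = (\<Sum>v\<in>UNIV. pmf (map_pmf f r) v
      * ln (pmf (map_pmf f r) v / pmf (map_pmf f q) v))"
    using D_KL_same_conditionals[OF r q] by (simp only: D_KL_def if_True)
  have split: "pmf p w * ln (pmf p w / pmf q w)
      = pmf p w * ln (pmf (map_pmf f r) (f w) / pmf (map_pmf f q) (f w))
        + pmf p w * ln (pmf p w / pmf r w)" for w
  proof (cases "w \<in> set_pmf p")
    case w: True
    have "pmf (map_pmf f r) (f w) / pmf (map_pmf f q) (f w) = pmf r w / pmf q w"
      using pos[OF w] r[of w] q[of w] by simp
    moreover have "pmf p w > 0" "pmf q w > 0" "pmf r w > 0"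
      using w True pr by (auto simp: pmf_positive_iff)
    ultimately show ?thesis by (simp add: ln_div algebra_simps)
  qed (simp add: set_pmf_iff)
  \<comment> \<open>The mean under \<open>p\<close> of a function of \<open>f w\<close> depends only
    on the marginal of \<open>p\<close>, which is that of \<open>r\<close>; this gives the sum in
    \<open>fin\<close>.\<close>
  have "(\<Sum>w\<in>UNIV. pmf p w * ln (pmf p w / pmf q w))
      = (\<Sum>v\<in>UNIV. pmf (map_pmf f r) v * ln (pmf (map_pmf f r) v / pmf (map_pmf f q) v))
        + (\<Sum>w\<in>UNIV. pmf p w * ln (pmf p w / pmf r w))"
    unfolding split sum.distrib
    using sum_pmf_map[of p "\<lambda>v. ln (pmf (map_pmf f r) v / pmf (map_pmf f q) v)" f]
    by (simp only: marg)
  then show ?thesis using True pr fin by (simp add: D_KL_def)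
next
  case False
  then have "\<not> set_pmf r \<subseteq> set_pmf q \<or> \<not> set_pmf p \<subseteq> set_pmf r" by blast
  then show ?thesis using False by (auto simp: D_KL_def)
qed

lemma marginal_X_half_step:
  "even t \<Longrightarrow> marginal_X (half_step_evolution PY PX p (Suc t)) = marginal_X (half_step_evolution PY PX p t)"
  by (simp add: map_bind_pmf map_pmf_comp bind_return_pmf')

lemma marginal_Y_half_step:
  "odd t \<Longrightarrow> marginal_Y (half_step_evolution PY PX p (Suc t)) = marginal_Y (half_step_evolution PY PX p t)"
  by (simp add: map_bind_pmf map_pmf_comp bind_return_pmf')

text \<open>Compatibility evaluated on the singletons \<open>A = {x}\<close> and
  \<open>B = {y}\<close>.\<close>

lemma pmf_edwards_sokal:
  fixes q :: "('x \<times> 'y) pmf"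
  assumes "edwards_sokal PY PX q"
  shows "pmf q (x, y) = pmf (PY x) y * pmf (marginal_X q) x"
    and "pmf q (x, y) = pmf (PX y) x * pmf (marginal_Y q) y"
proof -
  have "measure_pmf.prob q ({x} \<times> {y}) = (\<Sum>x\<in>{x}. measure_pmf.prob (PY x) {y} * pmf (marginal_X q) x)"
    "measure_pmf.prob q ({x} \<times> {y}) = (\<Sum>y\<in>{y}. measure_pmf.prob (PX y) {x} * pmf (marginal_Y q) y)"
    using assms unfolding edwards_sokal_def by blast+
  then show "pmf q (x, y) = pmf (PY x) y * pmf (marginal_X q) x"
    and "pmf q (x, y) = pmf (PX y) x * pmf (marginal_Y q) y"
    by (simp_all add: pmf.rep_eq)
qed

context
  fixes PY :: "'x::finite \<Rightarrow> 'y::finite pmf" and PX :: "'y \<Rightarrow> 'x pmf"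
    and q p0 :: "('x \<times> 'y) pmf" and p :: "nat \<Rightarrow> ('x \<times> 'y) pmf"
  assumes es: "edwards_sokal PY PX q"
  defines "p \<equiv> half_step_evolution PY PX p0"
begin

text \<open>The evolution rule uses the marginal at time \<open>t\<close>; since the step retains
  it, it may be replaced by the marginal at \<open>Suc t\<close>, the form in which
  \<open>p (Suc t)\<close> and \<open>q\<close> share the factor \<open>k\<close>.\<close>

lemma half_step_conditionals_X:
  assumes "even t"
  shows "pmf (p (Suc t)) w = (case w of (x, y) \<Rightarrow> pmf (PY x) y) * pmf (marginal_X (p (Suc t))) (fst w)"
  using assms unfolding p_def marginal_X_half_step[OF assms]
  by (cases w) (simp only: pmf_half_step_evolution_Suc if_True split fst_conv)

lemma half_step_conditionals_Y:
  assumes "odd t"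
  shows "pmf (p (Suc t)) w = (case w of (x, y) \<Rightarrow> pmf (PX y) x) * pmf (marginal_Y (p (Suc t))) (snd w)"
  using assms unfolding p_def marginal_Y_half_step[OF assms]
  by (cases w) (simp only: pmf_half_step_evolution_Suc if_False split snd_conv)

lemma edwards_sokal_conditionals:
  "pmf q w = (case w of (x, y) \<Rightarrow> pmf (PY x) y) * pmf (marginal_X q) (fst w)"
  "pmf q w = (case w of (x, y) \<Rightarrow> pmf (PX y) x) * pmf (marginal_Y q) (snd w)"
  using pmf_edwards_sokal[OF es] by (cases w; simp only: split fst_conv snd_conv)+

lemma D_KL_half_step: "D_KL (p t) q = D_KL (p (Suc t)) q + D_KL (p t) (p (Suc t))"
\<comment> \<open>Parity selects the retained coordinate: \<open>f = fst\<close> with kernel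
  \<open>PY\<close> at even times, \<open>f = snd\<close> with kernel \<open>PX\<close> at odd
  times.\<close>
proof (cases "even t")
  case True
  then show ?thesis
    using marginal_X_half_step[OF True, of PY PX p0]
    by (intro D_KL_pythagoras[OF _ half_step_conditionals_X edwards_sokal_conditionals(1)])
      (simp_all only: p_def)
next
  case False
  then show ?thesis
    using marginal_Y_half_step[OF False, of PY PX p0]
    by (intro D_KL_pythagoras[OF _ half_step_conditionals_Y edwards_sokal_conditionals(2)])
      (simp_all only: p_def not_False_eq_True)
qed

lemma D_KL_half_step_le: "D_KL (p (Suc t)) q \<le> D_KL (p t) q"
  unfolding D_KL_half_step[of t] by (intro ereal_le_add_self D_KL_nonneg)

lemma D_KL_marginal_X:
  "even t \<Longrightarrow> D_KL (p (Suc t)) q = D_KL (marginal_X (p (Suc t))) (marginal_X q)"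
  by (intro D_KL_same_conditionals[OF half_step_conditionals_X edwards_sokal_conditionals(1)])

lemma D_KL_marginal_Y:
  "odd t \<Longrightarrow> D_KL (p (Suc t)) q = D_KL (marginal_Y (p (Suc t))) (marginal_Y q)"
  by (intro D_KL_same_conditionals[OF half_step_conditionals_Y edwards_sokal_conditionals(2)])

lemma D_KL_marginals_le:
  assumes "even t"
  shows "D_KL (marginal_Y (p (Suc t))) (marginal_Y q) \<le> D_KL (marginal_X (p (Suc t))) (marginal_X q)"
    and "D_KL (marginal_X (p (Suc (Suc t)))) (marginal_X q)
      \<le> D_KL (marginal_Y (p (Suc (Suc t)))) (marginal_Y q)"
proof -
  have odd: "odd (Suc t)" and even: "even (Suc (Suc t))" using assms by simp_all
  \<comment> \<open>The right side is the joint divergence at \<open>Suc t\<close>. The left side is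
    the joint divergence one half-step later, because the odd step retains the
    \<open>Y\<close>-marginal.\<close>
  show "D_KL (marginal_Y (p (Suc t))) (marginal_Y q) \<le> D_KL (marginal_X (p (Suc t))) (marginal_X q)"
    using D_KL_half_step_le[of "Suc t"] D_KL_marginal_X[OF assms] D_KL_marginal_Y[OF odd]
      marginal_Y_half_step[OF odd, of PY PX p0] by (simp only: p_def)
  \<comment> \<open>The comparison is with the joint law at \<open>Suc (Suc (Suc t))\<close>: the
    \<open>X\<close>-marginal at \<open>Suc (Suc t)\<close> survives that even step, and only after
    it does it carry the whole joint divergence.\<close>
  show "D_KL (marginal_X (p (Suc (Suc t)))) (marginal_X q)
      \<le> D_KL (marginal_Y (p (Suc (Suc t)))) (marginal_Y q)"
    using D_KL_half_step_le[of "Suc (Suc t)"] D_KL_marginal_Y[OF odd] D_KL_marginal_X[OF even]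
      marginal_X_half_step[OF even, of PY PX p0] by (simp only: p_def)
qed

end

theorem theorem1p8:
  fixes PY :: "'x::finite \<Rightarrow> 'y::finite pmf"
    and PX :: "'y \<Rightarrow> 'x pmf"
    and \<pi>\<^sub>E\<^sub>S \<pi>\<^sub>0 :: "('x \<times> 'y) pmf"
    and \<pi> :: "nat \<Rightarrow> ('x \<times> 'y) pmf"
    and \<mu> :: "nat \<Rightarrow> 'x pmf" and \<nu> :: "nat \<Rightarrow> 'y pmf"
    and \<mu>\<^sub>E\<^sub>S :: "'x pmf" and \<nu>\<^sub>E\<^sub>S :: "'y pmf"
    and t\<^sub>0 :: nat
  assumes "irreducible_kernel (primal_kernel PY PX)"
    and "aperiodic_kernel (primal_kernel PY PX)"
    and "edwards_sokal PY PX \<pi>\<^sub>E\<^sub>S"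
    and "set_pmf (marginal_Y \<pi>\<^sub>E\<^sub>S) = UNIV"
    and "\<pi> = half_step_evolution PY PX \<pi>\<^sub>0"
    and "t\<^sub>0 = burn_in_time PY PX \<pi>\<^sub>E\<^sub>S"
    and "\<mu> = (\<lambda>k. marginal_X (\<pi> k))" and "\<nu> = (\<lambda>k. marginal_Y (\<pi> k))"
    and "\<mu>\<^sub>E\<^sub>S = marginal_X \<pi>\<^sub>E\<^sub>S" and "\<nu>\<^sub>E\<^sub>S = marginal_Y \<pi>\<^sub>E\<^sub>S"
  shows "(\<forall>t\<ge>t\<^sub>0. D_RKL \<pi>\<^sub>E\<^sub>S (\<pi> t) = D_RKL \<pi>\<^sub>E\<^sub>S (\<pi> (t + 1)) + D_RKL (\<pi> (t + 1)) (\<pi> t))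
    \<and> antimono_on {t\<^sub>0..} (\<lambda>t. D_KL (\<pi> t) \<pi>\<^sub>E\<^sub>S)
    \<and> (\<forall>t>t\<^sub>0. even t \<longrightarrow>
          D_RKL \<mu>\<^sub>E\<^sub>S (\<mu> t) \<ge> D_RKL \<mu>\<^sub>E\<^sub>S (\<mu> (t + 1))
        \<and> D_RKL \<mu>\<^sub>E\<^sub>S (\<mu> (t + 1)) \<ge> D_RKL \<nu>\<^sub>E\<^sub>S (\<nu> (t + 1))
        \<and> D_RKL \<nu>\<^sub>E\<^sub>S (\<nu> (t + 1)) \<ge> D_RKL \<nu>\<^sub>E\<^sub>S (\<nu> (t + 2))
        \<and> D_RKL \<nu>\<^sub>E\<^sub>S (\<nu> (t + 2)) \<ge> D_RKL \<mu>\<^sub>E\<^sub>S (\<mu> (t + 2)))"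
proof -
  note es = assms(3)
  have pythagoras: "D_RKL \<pi>\<^sub>E\<^sub>S (\<pi> t) = D_RKL \<pi>\<^sub>E\<^sub>S (\<pi> (t + 1)) + D_RKL (\<pi> (t + 1)) (\<pi> t)" for t
    using D_KL_half_step[OF es, of \<pi>\<^sub>0 t] by (simp only: assms(5) D_RKL_def Suc_eq_plus1)
  have antimono: "antimono_on {t\<^sub>0..} (\<lambda>t. D_KL (\<pi> t) \<pi>\<^sub>E\<^sub>S)"
    using lift_Suc_antimono_le[of "\<lambda>t. D_KL (\<pi> t) \<pi>\<^sub>E\<^sub>S"] D_KL_half_step_le[OF es, of \<pi>\<^sub>0]
    unfolding assms(5) by (intro monotone_onI) blast
  have "D_RKL \<mu>\<^sub>E\<^sub>S (\<mu> t) \<ge> D_RKL \<mu>\<^sub>E\<^sub>S (\<mu> (t + 1))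
      \<and> D_RKL \<mu>\<^sub>E\<^sub>S (\<mu> (t + 1)) \<ge> D_RKL \<nu>\<^sub>E\<^sub>S (\<nu> (t + 1))
      \<and> D_RKL \<nu>\<^sub>E\<^sub>S (\<nu> (t + 1)) \<ge> D_RKL \<nu>\<^sub>E\<^sub>S (\<nu> (t + 2))
      \<and> D_RKL \<nu>\<^sub>E\<^sub>S (\<nu> (t + 2)) \<ge> D_RKL \<mu>\<^sub>E\<^sub>S (\<mu> (t + 2))" if "even t" for t
  proof -
    have "odd (Suc t)" using that by simp
    \<comment> \<open>The first and third inequalities of the chain are equalities; the other two
      come from the loss of joint divergence in a half-step.\<close>
    have "\<mu> (t + 1) = \<mu> t" "\<nu> (t + 2) = \<nu> (t + 1)"
      using marginal_X_half_step[OF that, of PY PX \<pi>\<^sub>0]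
        marginal_Y_half_step[OF \<open>odd (Suc t)\<close>, of PY PX \<pi>\<^sub>0]
      by (simp_all only: assms(5,7,8) Suc_eq_plus1[symmetric] add_2_eq_Suc')
    moreover have "D_RKL \<mu>\<^sub>E\<^sub>S (\<mu> (t + 1)) \<ge> D_RKL \<nu>\<^sub>E\<^sub>S (\<nu> (t + 1))"
      "D_RKL \<nu>\<^sub>E\<^sub>S (\<nu> (t + 2)) \<ge> D_RKL \<mu>\<^sub>E\<^sub>S (\<mu> (t + 2))"
      using D_KL_marginals_le[OF es that, of \<pi>\<^sub>0]
      by (simp_all only: assms(5,7-10) D_RKL_def Suc_eq_plus1[symmetric] add_2_eq_Suc')
    ultimately show ?thesis by simp
  qed
  then show ?thesis using pythagoras antimono by blast
qed

end
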